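(* For every simple tree $T$ there is a constant $C_T$ such that $\operatorname{gr}(T,K_k)\le C_T k$ for all integers $k\ge 1$.
   Context: A grid subgraph on $c$ columns and $r$ rows is a graph whose vertex set is a subset of $[c]\times[r]$ (vertex $(x,y)$ lies in column $x$, row $y$) and whose edges each join two vertices in the same row or in the same column. $G_{N\times N}=K_N\square K_N$ is the complete grid graph; a spanning grid subgraph is a spanning subgraph of it. An embedding of a grid subgraph $H$ (on $c_H$ columns, $r_H$ rows) into a grid subgraph $G$ (on $c_G$ columns, $r_G$ rows) is a pair of injections $\varphi_c:[c_H]\to[c_G]$, $\varphi_r:[r_H]\to[r_G]$ mapping each edge $\{(x,y),(x',y')\}$ of $H$ to an edge $\{(\varphi_c(x),\varphi_r(y)),(\varphi_c(x'),\varphi_r(y'))\}$ of $G$; $G$ contains $H$ if an embedding exists. A coclique of size $k$ in $G$ is a set of $k$ pairwise non-adjacent vertices all in one row or all in one column. $\operatorname{gr}(H,K_k)$ is the least $N$ such that every spanning grid subgraph of $G_{N\times N}$ contains $H$ or a coclique of size $k$. A grid subgraph is simple if, for each row and each column, the subgraph induced on its vertices in that row (resp. column) is connected. A simple tree is a grid subgraph which is a tree (connected and acyclic as a graph) and is simple. *)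

theory Defs
  imports Complex_Main
begin

record grid_graph =
  ncols :: nat
  nrows :: nat
  gverts :: "(nat \<times> nat) set"
  gedges :: "(nat \<times> nat) set set"

text \<open>Here $[n]$ is \<open>{1..n}\<close>, and a vertex \<open>(x, y)\<close> lies in column \<open>x\<close> and row \<open>y\<close>.\<close>

definition grid_subgraph :: "grid_graph \<Rightarrow> bool" where
  "grid_subgraph G \<longleftrightarrow>
     gverts G \<subseteq> {1..ncols G} \<times> {1..nrows G} \<and>
     (\<forall>e\<in>gedges G. \<exists>u\<in>gverts G. \<exists>v\<in>gverts G.
        e = {u, v} \<and> u \<noteq> v \<and> (fst u = fst v \<or> snd u = snd v))"

definition complete_grid :: "nat \<Rightarrow> grid_graph" where
  "complete_grid N = \<lparr> ncols = N, nrows = N, gverts = {1..N} \<times> {1..N},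
     gedges = {{u, v} | u v. u \<in> {1..N} \<times> {1..N} \<and> v \<in> {1..N} \<times> {1..N} \<and>
                 u \<noteq> v \<and> (fst u = fst v \<or> snd u = snd v)} \<rparr>"

definition spanning_grid_subgraph :: "nat \<Rightarrow> grid_graph \<Rightarrow> bool" where
  "spanning_grid_subgraph N G \<longleftrightarrow>
     ncols G = ncols (complete_grid N) \<and> nrows G = nrows (complete_grid N) \<and>
     gverts G = gverts (complete_grid N) \<and> gedges G \<subseteq> gedges (complete_grid N)"

definition grid_embedding ::
  "(nat \<Rightarrow> nat) \<Rightarrow> (nat \<Rightarrow> nat) \<Rightarrow> grid_graph \<Rightarrow> grid_graph \<Rightarrow> bool" where
  "grid_embedding \<phi>c \<phi>r H G \<longleftrightarrow>
     inj_on \<phi>c {1..ncols H} \<and> \<phi>c ` {1..ncols H} \<subseteq> {1..ncols G} \<and>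
     inj_on \<phi>r {1..nrows H} \<and> \<phi>r ` {1..nrows H} \<subseteq> {1..nrows G} \<and>
     (\<forall>x y x' y'. {(x, y), (x', y')} \<in> gedges H \<longrightarrow>
        {(\<phi>c x, \<phi>r y), (\<phi>c x', \<phi>r y')} \<in> gedges G)"

definition grid_contains :: "grid_graph \<Rightarrow> grid_graph \<Rightarrow> bool" where
  "grid_contains G H \<longleftrightarrow> (\<exists>\<phi>c \<phi>r. grid_embedding \<phi>c \<phi>r H G)"

definition grid_coclique :: "grid_graph \<Rightarrow> nat \<Rightarrow> (nat \<times> nat) set \<Rightarrow> bool" where
  "grid_coclique G k S \<longleftrightarrow>
     S \<subseteq> gverts G \<and> finite S \<and> card S = k \<and>
     (\<forall>u\<in>S. \<forall>v\<in>S. {u, v} \<notin> gedges G) \<and>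
     ((\<exists>x. \<forall>u\<in>S. fst u = x) \<or> (\<exists>y. \<forall>u\<in>S. snd u = y))"

definition gr_property :: "grid_graph \<Rightarrow> nat \<Rightarrow> nat \<Rightarrow> bool" where
  "gr_property H k N \<longleftrightarrow>
     (\<forall>G. spanning_grid_subgraph N G \<longrightarrow>
        grid_contains G H \<or> (\<exists>S. grid_coclique G k S))"

text \<open>Since \<open>Least\<close> is unspecified when no \<open>N\<close> has the property, a bound on \<open>gr H k\<close>
  is meaningful only together with \<open>\<exists>N. gr_property H k N\<close>.\<close>

definition gr :: "grid_graph \<Rightarrow> nat \<Rightarrow> nat" where
  "gr H k = (LEAST N. gr_property H k N)"

text \<open>The empty graph satisfies \<open>graph_connected\<close>: a row or column without vertices imposes no
  condition in \<open>simple_grid\<close>. Nonemptiness is required separately in \<open>graph_tree\<close>.\<close>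

definition graph_connected :: "'a set \<Rightarrow> 'a set set \<Rightarrow> bool" where
  "graph_connected V E \<longleftrightarrow> (\<forall>u\<in>V. \<forall>v\<in>V. (u, v) \<in> {(a, b). {a, b} \<in> E}\<^sup>*)"

definition induced_edges :: "'a set set \<Rightarrow> 'a set \<Rightarrow> 'a set set" where
  "induced_edges E S = {e \<in> E. e \<subseteq> S}"

definition graph_cycle :: "'a set set \<Rightarrow> 'a list \<Rightarrow> bool" where
  "graph_cycle E cs \<longleftrightarrow>
     3 \<le> length cs \<and> distinct cs \<and>
     (\<forall>i<length cs. {cs ! i, cs ! ((i + 1) mod length cs)} \<in> E)"

definition graph_tree :: "'a set \<Rightarrow> 'a set set \<Rightarrow> bool" where
  "graph_tree V E \<longleftrightarrow> V \<noteq> {} \<and> graph_connected V E \<and> \<not> (\<exists>cs. graph_cycle E cs)"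

definition row_verts :: "grid_graph \<Rightarrow> nat \<Rightarrow> (nat \<times> nat) set" where
  "row_verts G y = {v \<in> gverts G. snd v = y}"

definition col_verts :: "grid_graph \<Rightarrow> nat \<Rightarrow> (nat \<times> nat) set" where
  "col_verts G x = {v \<in> gverts G. fst v = x}"

definition simple_grid :: "grid_graph \<Rightarrow> bool" where
  "simple_grid G \<longleftrightarrow>
     (\<forall>y\<in>{1..nrows G}. graph_connected (row_verts G y) (induced_edges (gedges G) (row_verts G y))) \<and>
     (\<forall>x\<in>{1..ncols G}. graph_connected (col_verts G x) (induced_edges (gedges G) (col_verts G x)))"

definition simple_tree :: "grid_graph \<Rightarrow> bool" where
  "simple_tree T \<longleftrightarrow>
     grid_subgraph T \<and> graph_tree (gverts T) (gedges T) \<and> simple_grid T"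

end

theory Submission
  imports Defs
begin

text \<open>
  Let \<open>D\<close> exceed the number of rows plus the number of columns of \<open>T\<close>, and let \<open>N = 2Dk\<close>.
  Repeatedly delete from the grid a vertex with fewer than \<open>D\<close> surviving neighbours in its row or
  fewer than \<open>D\<close> surviving neighbours in its column. If everything gets deleted, reinserting the
  vertices in reverse order and colouring greedily assigns to each vertex one of the two
  directions and one of \<open>D\<close> colours, such that vertices of one line with the direction of that
  line and the same colour are non-adjacent. These \<open>2DN\<close> classes cover \<open>N\<^sup>2 = 2DkN\<close> vertices, so one
  of them contains a coclique of size \<open>k\<close>. Otherwise a nonempty core survives, in which all row
  and column degrees are at least \<open>D\<close>, and \<open>T\<close> is embedded into the core vertex by vertex: as
  \<open>T\<close> is acyclic and simple, a vertex attached along a row edge lies in a column not used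
  before, so that any of the \<open>D\<close> neighbours outside the used columns can be chosen.
\<close>

section \<open>Acyclic graphs\<close>

text \<open>Prepending a step keeps the path simple unless its new start already occurs; then the
  part from that occurrence on is kept instead.\<close>

lemma rtrancl_imp_distinct_path:
  assumes "(a, b) \<in> R\<^sup>*"
  shows "\<exists>xs. xs \<noteq> [] \<and> hd xs = a \<and> last xs = b \<and> distinct xs \<and> successively (\<lambda>x y. (x, y) \<in> R) xs"
  using assms
proof (induction rule: converse_rtrancl_induct)
  case base
  show ?case by (intro exI[of _ "[b]"]) auto
next
  case (step a c)
  then obtain xs where xs: "xs \<noteq> []" "hd xs = c" "last xs = b" "distinct xs"
      "successively (\<lambda>x y. (x, y) \<in> R) xs"
    by blast
  show ?case
  proof (cases "a \<in> set xs")
    case True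
    then obtain ys zs where "xs = ys @ a # zs"
      by (auto simp: in_set_conv_decomp)
    with xs show ?thesis
      by (intro exI[of _ "a # zs"]) (auto simp: successively_append_iff)
  next
    case False
    with xs step.hyps show ?thesis
      by (intro exI[of _ "a # xs"]) (auto simp: successively_Cons)
  qed
qed

text \<open>A simple path from \<open>v\<close> to \<open>u\<close> avoiding the edge is closed up
  by that edge.\<close>

lemma graph_cycle_if_edge_and_detour:
  assumes edge: "{u, v} \<in> E" and "u \<noteq> v"
    and detour: "(v, u) \<in> {(a, b). {a, b} \<in> E - {{u, v}}}\<^sup>*"
  shows "\<exists>cs. graph_cycle E cs"
proof -
  obtain xs where xs: "xs \<noteq> []" "hd xs = v" "last xs = u" "distinct xs"
      and path: "successively (\<lambda>x y. (x, y) \<in> {(a, b). {a, b} \<in> E - {{u, v}}}) xs"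
    using rtrancl_imp_distinct_path[OF detour] by blast
  have step: "{xs ! i, xs ! Suc i} \<in> E - {{u, v}}" if "Suc i < length xs" for i
    using path that by (auto simp: successively_conv_nth)
  have first: "xs ! 0 = v" and final: "xs ! (length xs - 1) = u"
    using xs by (auto simp: hd_conv_nth last_conv_nth)
  have "length xs \<noteq> 0" "length xs \<noteq> 1"
    using xs first final \<open>u \<noteq> v\<close> by auto
  \<comment> \<open>A path on two vertices would consist of the deleted edge itself.\<close>
  moreover have "length xs \<noteq> 2"
    using step[of 0] first final by (auto simp: insert_commute)
  ultimately have len: "3 \<le> length xs" by linarith
  have "{xs ! i, xs ! ((i + 1) mod length xs)} \<in> E" if "i < length xs" for i
  proof (cases "Suc i < length xs")
    case True
    with step[of i] show ?thesis by simp
  next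
    case False
    with that have "Suc i = length xs" by simp
    then have "i = length xs - 1" "(i + 1) mod length xs = 0" by auto
    with first final edge show ?thesis by simp
  qed
  with len xs show ?thesis by (auto simp: graph_cycle_def)
qed

text \<open>A second link from \<open>v\<close> to the connected part \<open>P\<close> would close a cycle through \<open>u\<close>.\<close>

lemma no_detour_into_connected_part:
  assumes acyclic: "\<nexists>cs. graph_cycle E cs"
    and P: "graph_connected P (induced_edges E P)"
    and edge: "{u, v} \<in> E" "u \<in> P" "v \<notin> P" and "w \<in> P"
  shows "(v, w) \<notin> {(a, b). {a, b} \<in> E - {{u, v}}}\<^sup>*"
proof
  let ?R = "{(a, b). {a, b} \<in> E - {{u, v}}}"
  assume "(v, w) \<in> ?R\<^sup>*"
  \<comment> \<open>No edge inside \<open>P\<close> contains \<open>v\<close>, so all of them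
    survive the deletion.\<close>
  moreover have "{(a, b). {a, b} \<in> induced_edges E P} \<subseteq> ?R"
    using \<open>v \<notin> P\<close> by (auto simp: induced_edges_def doubleton_eq_iff)
  then have "(w, u) \<in> ?R\<^sup>*"
    using P \<open>u \<in> P\<close> \<open>w \<in> P\<close> rtrancl_mono unfolding graph_connected_def by blast
  ultimately have "(v, u) \<in> ?R\<^sup>*" by (rule rtrancl_trans)
  with edge acyclic show False
    using graph_cycle_if_edge_and_detour[of u v E] by auto
qed

text \<open>A second edge from \<open>v\<close> into \<open>P\<close> would be a detour of length
  one.\<close>

lemma unique_edge_into_connected_part:
  assumes "\<nexists>cs. graph_cycle E cs" "graph_connected P (induced_edges E P)"
    and "{u, v} \<in> E" "u \<in> P" "v \<notin> P" and w: "w \<in> P" "{v, w} \<in> E"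
  shows "w = u"
proof (rule ccontr)
  assume "w \<noteq> u"
  with w \<open>v \<notin> P\<close> have "(v, w) \<in> {(a, b). {a, b} \<in> E - {{u, v}}}"
    by (auto simp: doubleton_eq_iff)
  then show False
    using no_detour_into_connected_part[OF assms(1-5) w(1)] by auto
qed

lemma line_fresh_for_connected_part:
  assumes "\<nexists>cs. graph_cycle E cs" "graph_connected P (induced_edges E P)"
    and "{u, v} \<in> E" "u \<in> P" "v \<notin> P"
    and "P \<subseteq> V" "v \<in> V" and "p u \<noteq> p v"
    and line: "graph_connected {x \<in> V. p x = p v} (induced_edges E {x \<in> V. p x = p v})"
  shows "p v \<notin> p ` P"
proof
  assume "p v \<in> p ` P"
  then obtain w where w: "w \<in> P" "p w = p v" by auto
  let ?L = "{x \<in> V. p x = p v}"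
  have "(v, w) \<in> {(a, b). {a, b} \<in> induced_edges E ?L}\<^sup>*"
    using line w \<open>P \<subseteq> V\<close> \<open>v \<in> V\<close> unfolding graph_connected_def by blast
  moreover have "{(a, b). {a, b} \<in> induced_edges E ?L} \<subseteq> {(a, b). {a, b} \<in> E - {{u, v}}}"
    using \<open>p u \<noteq> p v\<close> by (auto simp: induced_edges_def doubleton_eq_iff)
  ultimately show False
    using no_detour_into_connected_part[OF assms(1-5) w(1)] rtrancl_mono by blast
qed

lemma graph_connected_insert:
  assumes P: "graph_connected P (induced_edges E P)" and "{u, v} \<in> E" "u \<in> P"
  shows "graph_connected (insert v P) (induced_edges E (insert v P))"
proof -
  let ?R = "{(a, b). {a, b} \<in> induced_edges E (insert v P)}"
  have "{(a, b). {a, b} \<in> induced_edges E P} \<subseteq> ?R"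
    by (auto simp: induced_edges_def)
  then have old: "(a, b) \<in> ?R\<^sup>*" if "a \<in> P" "b \<in> P" for a b
    using P that rtrancl_mono unfolding graph_connected_def by blast
  have new: "(u, v) \<in> ?R" "(v, u) \<in> ?R"
    using assms by (auto simp: induced_edges_def insert_commute)
  have "(a, u) \<in> ?R\<^sup>*" "(u, a) \<in> ?R\<^sup>*" if "a \<in> insert v P" for a
    using that old \<open>u \<in> P\<close> new by auto
  then show ?thesis
    unfolding graph_connected_def by (meson rtrancl_trans)
qed

lemma graph_connected_crossing_edge:
  assumes "graph_connected V E" "P \<subseteq> V" "P \<noteq> {}" "P \<noteq> V"
  obtains u v where "u \<in> P" "v \<notin> P" "{u, v} \<in> E"
proof -
  obtain a b where ab: "a \<in> P" "b \<in> V" "b \<notin> P" using assms by blast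
  with assms have "(a, b) \<in> {(a, b). {a, b} \<in> E}\<^sup>*"
    unfolding graph_connected_def by blast
  then have "b \<notin> P \<Longrightarrow> \<exists>u v. u \<in> P \<and> v \<notin> P \<and> {u, v} \<in> E"
    by (induction rule: rtrancl_induct) (use ab in auto)
  with ab that show thesis by blast
qed

section \<open>Dense cores\<close>

text \<open>Induction by deleting a vertex \<open>v\<close> of low degree in some direction
  \<open>b\<close>: once the rest is coloured, \<open>v\<close> receives direction \<open>b\<close>
  and a colour missing among its fewer than \<open>D\<close> neighbours in that direction.\<close>

lemma two_direction_greedy_colouring:
  fixes adj :: "bool \<Rightarrow> 'a \<Rightarrow> 'a \<Rightarrow> bool"
  assumes "finite V"
    and sym: "\<And>b u v. adj b u v \<Longrightarrow> adj b v u" and irrefl: "\<And>b u. \<not> adj b u u"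
    and low: "\<And>S. S \<subseteq> V \<Longrightarrow> S \<noteq> {} \<Longrightarrow> \<exists>v\<in>S. \<exists>b. card {w \<in> S. adj b v w} < D"
  shows "\<exists>c. (\<forall>v\<in>V. snd (c v) < D) \<and> (\<forall>u\<in>V. \<forall>v\<in>V. adj (fst (c u)) u v \<longrightarrow> c u \<noteq> c v)"
  using assms(1) low
proof (induction V rule: finite_psubset_induct)
  case (psubset V)
  show ?case
  proof (cases "V = {}")
    case False
    then obtain v b where v: "v \<in> V" "card {w \<in> V. adj b v w} < D"
      using psubset.prems[of V] by blast
    have "V - {v} \<subset> V" using v by blast
    moreover have "\<exists>v\<in>S. \<exists>b. card {w \<in> S. adj b v w} < D" if "S \<subseteq> V - {v}" "S \<noteq> {}" for S
      using that by (intro psubset.prems) auto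
    ultimately obtain c where c: "\<forall>u\<in>V - {v}. snd (c u) < D"
        "\<forall>u\<in>V - {v}. \<forall>w\<in>V - {v}. adj (fst (c u)) u w \<longrightarrow> c u \<noteq> c w"
      using psubset.IH[of "V - {v}"] by blast
    let ?used = "(snd \<circ> c) ` {w \<in> V. adj b v w}"
    have "card ?used < D"
      using v(2) psubset.hyps card_image_le[of "{w \<in> V. adj b v w}" "snd \<circ> c"] by simp
    then have "\<not> {..<D} \<subseteq> ?used"
      using psubset.hyps card_mono[of ?used "{..<D}"] by auto
    then obtain i where i: "i < D" "i \<notin> ?used" by auto
    show ?thesis
    proof (intro exI[of _ "c(v := (b, i))"] conjI ballI impI)
      fix u w assume uw: "u \<in> V" "w \<in> V" and adj: "adj (fst ((c(v := (b, i))) u)) u w"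
      have avoid: "c x \<noteq> (b, i)" if "x \<in> V" "adj b v x" for x
        using i(2) that by (force simp: image_iff)
      show "(c(v := (b, i))) u \<noteq> (c(v := (b, i))) w"
      \<comment> \<open>If \<open>v\<close> comes second, the direction of the conflict is that of
        \<open>u\<close>; equal pairs would make it \<open>b\<close>, and symmetry then contradicts
        \<open>avoid\<close>.\<close>
      proof (cases "u = v \<or> w = v")
        case True
        then show ?thesis
          using avoid[of u] avoid[of w] sym[of b u v] irrefl[of _ v] uw adj by (auto split: if_splits)
      qed (use c(2) uw adj in auto)
    qed (use c i in auto)
  qed auto
qed

text \<open>Pigeonhole principle, used to find a class of at least \<open>k\<close>
  vertices.\<close>

lemma exists_large_fibre:
  assumes "finite B" "f ` A \<subseteq> B" and large: "card B * m < card A"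
  shows "\<exists>b\<in>B. m < card {a \<in> A. f a = b}"
proof (rule ccontr)
  assume "\<not> ?thesis"
  then have small: "\<And>b. b \<in> B \<Longrightarrow> card {a \<in> A. f a = b} \<le> m" by force
  have "A = (\<Union>b\<in>B. {a \<in> A. f a = b})" using assms by auto
  then have "card A \<le> (\<Sum>b\<in>B. card {a \<in> A. f a = b})"
    using card_UN_le[OF \<open>finite B\<close>, of "\<lambda>b. {a \<in> A. f a = b}"] by simp
  also have "\<dots> \<le> card B * m"
    using sum_bounded_above[of B "\<lambda>b. card {a \<in> A. f a = b}" m] small by simp
  finally show False using large by simp
qed

text \<open>The Boolean direction \<open>True\<close> stands for rows, \<open>False\<close> for columns.\<close>

definition line :: "bool \<Rightarrow> nat \<times> nat \<Rightarrow> nat" where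
  "line b v = (if b then snd v else fst v)"

definition line_adjacent :: "grid_graph \<Rightarrow> bool \<Rightarrow> nat \<times> nat \<Rightarrow> nat \<times> nat \<Rightarrow> bool" where
  "line_adjacent G b u v \<longleftrightarrow> {u, v} \<in> gedges G \<and> line b u = line b v"

lemma dense_core_or_coclique:
  assumes G: "spanning_grid_subgraph N G" and N: "N = 2 * D * k" and "N > 0"
    and no_coclique: "\<nexists>S. grid_coclique G k S"
  obtains S where "S \<subseteq> gverts G" "S \<noteq> {}"
    "\<And>v b. v \<in> S \<Longrightarrow> D \<le> card {w \<in> S. line_adjacent G b v w}"
proof (rule ccontr)
  note core = that
  assume no_core: "\<not> thesis"
  let ?V = "{1..N} \<times> {1..N}"
  have V: "gverts G = ?V" using G by (simp add: spanning_grid_subgraph_def complete_grid_def)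
  have loopless: "{u, u} \<notin> gedges G" for u
    using G by (auto simp: spanning_grid_subgraph_def complete_grid_def doubleton_eq_iff)
  have low: "\<exists>v\<in>S. \<exists>b. card {w \<in> S. line_adjacent G b v w} < D" if "S \<subseteq> ?V" "S \<noteq> {}" for S
    using no_core core[of S] V that by (metis not_le)
  have "\<exists>c. (\<forall>v\<in>?V. snd (c v) < D) \<and>
      (\<forall>u\<in>?V. \<forall>v\<in>?V. line_adjacent G (fst (c u)) u v \<longrightarrow> c u \<noteq> c v)"
    by (rule two_direction_greedy_colouring)
      (use loopless low in \<open>auto simp: line_adjacent_def insert_commute\<close>)
  then obtain c where "(\<forall>v\<in>?V. snd (c v) < D) \<and>
      (\<forall>u\<in>?V. \<forall>v\<in>?V. line_adjacent G (fst (c u)) u v \<longrightarrow> c u \<noteq> c v)" ..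
  then have c: "\<And>v. v \<in> ?V \<Longrightarrow> snd (c v) < D"
    "\<And>u v. u \<in> ?V \<Longrightarrow> v \<in> ?V \<Longrightarrow> line_adjacent G (fst (c u)) u v \<Longrightarrow> c u \<noteq> c v"
    by metis+
  \<comment> \<open>Recording the line as well places each class within a single row or
    column.\<close>
  let ?f = "\<lambda>v. (c v, line (fst (c v)) v)"
  let ?B = "((UNIV :: bool set) \<times> {..<D}) \<times> {1..N}"
  have "?f v \<in> ?B" if "v \<in> ?V" for v
    using c(1)[OF that] that by (cases "c v") (auto simp: line_def)
  then have "?f ` ?V \<subseteq> ?B" by blast
  \<comment> \<open>There are \<open>2 * D * N\<close> classes for \<open>2 * D * k * N\<close>
    vertices. Since \<open>N > 0\<close> makes \<open>k\<close> positive, \<open>k - 1\<close> does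
    not truncate, and more than \<open>k - 1\<close> members means at least
    \<open>k\<close>.\<close>
  moreover have "card ?B * (k - 1) < card ?V"
  proof -
    have "card ?B * (k - 1) = 2 * D * N * (k - 1)" by (simp add: card_cartesian_product)
    also have "\<dots> < 2 * D * N * k" using N \<open>N > 0\<close> by simp
    also have "\<dots> = card ?V" using N by (simp add: card_cartesian_product)
    finally show ?thesis .
  qed
  ultimately obtain z where "k - 1 < card {v \<in> ?V. ?f v = z}"
    using exists_large_fibre[of ?B ?f ?V "k - 1"] by auto
  then have "k \<le> card {v \<in> ?V. ?f v = z}" by linarith
  then obtain S where S: "S \<subseteq> {v \<in> ?V. ?f v = z}" "card S = k" "finite S"
    by (rule obtain_subset_with_card_n)
  \<comment> \<open>Within a class an edge would be \<open>line_adjacent\<close> in the common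
    direction, but \<open>c\<close> separates such pairs.\<close>
  have "{u, v} \<notin> gedges G" if "u \<in> S" "v \<in> S" for u v
  proof -
    have "?f u = z" "?f v = z" "u \<in> ?V" "v \<in> ?V" using that S(1) by blast+
    with c(2)[of u v] show ?thesis by (auto simp: line_adjacent_def)
  qed
  moreover have "(\<exists>x. \<forall>u\<in>S. fst u = x) \<or> (\<exists>y. \<forall>u\<in>S. snd u = y)"
  proof -
    have "line (fst (fst z)) v = snd z" if "v \<in> S" for v
      using that S(1) by auto
    then show ?thesis by (cases "fst (fst z)") (auto simp: line_def)
  qed
  ultimately have "grid_coclique G k S"
    using S V unfolding grid_coclique_def by auto
  with no_coclique show False by blast
qed

section \<open>Embedding into a dense core\<close>

text \<open>Injectivity is required only on the columns and rows that \<open>P\<close> meets, so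
  that a new one can receive its image later; \<open>S\<close> will be the dense core.\<close>

definition partial_embedding ::
  "(nat \<times> nat) set set \<Rightarrow> (nat \<times> nat) set \<Rightarrow> (nat \<times> nat) set set \<Rightarrow> (nat \<times> nat) set \<Rightarrow>
    (nat \<Rightarrow> nat) \<Rightarrow> (nat \<Rightarrow> nat) \<Rightarrow> bool" where
  "partial_embedding E P F S f g \<longleftrightarrow>
     inj_on f (fst ` P) \<and> inj_on g (snd ` P) \<and> map_prod f g ` P \<subseteq> S \<and>
     (\<forall>a\<in>P. \<forall>b\<in>P. {a, b} \<in> E \<longrightarrow> {map_prod f g a, map_prod f g b} \<in> F)"

lemma partial_embedding_add_column:
  assumes emb: "partial_embedding E P F S f g"
    and "(x, y) \<in> P" and fresh: "x' \<notin> fst ` P" "c \<notin> f ` fst ` P"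
    and only: "\<And>w. w \<in> P \<Longrightarrow> {(x', y), w} \<in> E \<Longrightarrow> w = (x, y)" and "{(x', y)} \<notin> E"
    and "(c, g y) \<in> S" "{(f x, g y), (c, g y)} \<in> F"
  shows "partial_embedding E (insert (x', y) P) F S (f(x' := c)) g"
proof -
  let ?f = "f(x' := c)"
  have same: "map_prod ?f g a = map_prod f g a" if "a \<in> P" for a
    using that fresh(1) by (cases a) force
  have new: "map_prod ?f g (x', y) = (c, g y)" by simp
  have "inj_on ?f (fst ` insert (x', y) P)"
    using emb fresh by (auto simp: partial_embedding_def inj_on_def)
  moreover have "inj_on g (snd ` insert (x', y) P)"
    using emb \<open>(x, y) \<in> P\<close> by (metis partial_embedding_def image_insert insert_absorb rev_image_eqI snd_conv)
  moreover have "map_prod ?f g ` insert (x', y) P \<subseteq> S"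
    using emb same new \<open>(c, g y) \<in> S\<close> unfolding partial_embedding_def by auto
  moreover have "{map_prod ?f g a, map_prod ?f g b} \<in> F"
    if ab: "a \<in> insert (x', y) P" "b \<in> insert (x', y) P" "{a, b} \<in> E" for a b
  proof -
    consider "a \<in> P" "b \<in> P" | "a = (x', y)" "b = (x, y)" | "a = (x, y)" "b = (x', y)"
    proof (cases "a = (x', y)")
      case True
      then have "b \<noteq> (x', y)" using ab(3) \<open>{(x', y)} \<notin> E\<close> by auto
      with True ab only[of b] that(2) show thesis by blast
    next
      case False
      with ab only[of a] that(1,3) show thesis by (metis insertE insert_commute)
    qed
    then show ?thesis
    proof cases
      case 1
      with same emb ab(3) show ?thesis unfolding partial_embedding_def by auto
    next
      case 2
      with same[OF \<open>(x, y) \<in> P\<close>] new assms(8) show ?thesis by (simp add: insert_commute)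
    next
      case 3
      with same[OF \<open>(x, y) \<in> P\<close>] new assms(8) show ?thesis by simp
    qed
  qed
  ultimately show ?thesis unfolding partial_embedding_def by blast
qed

text \<open>Transposing both graphs exchanges the coordinate maps; this reduces adding a row to
  adding a column.\<close>

lemma partial_embedding_swap:
  "partial_embedding ((`) prod.swap ` E) (prod.swap ` P) ((`) prod.swap ` F) (prod.swap ` S) g f
     \<longleftrightarrow> partial_embedding E P F S f g"
proof -
  have swap_mem: "A \<in> (`) prod.swap ` X \<longleftrightarrow> prod.swap ` A \<in> X"
    for A :: "(nat \<times> nat) set" and X
  proof
    assume "prod.swap ` A \<in> X"
    then have "prod.swap ` (prod.swap ` A) \<in> (`) prod.swap ` X" by (rule imageI)
    then show "A \<in> (`) prod.swap ` X" by (simp add: image_image)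
  qed (auto simp: image_image)
  have "fst ` prod.swap ` P = snd ` P" "snd ` prod.swap ` P = fst ` P"
    by (simp_all add: image_image)
  moreover have "map_prod g f ` prod.swap ` P \<subseteq> prod.swap ` S \<longleftrightarrow> map_prod f g ` P \<subseteq> S"
    by (force simp: image_subset_iff image_iff)
  moreover have "prod.swap (map_prod g f (prod.swap a)) = map_prod f g a" for a
    by (cases a) simp
  ultimately show ?thesis
    unfolding partial_embedding_def by (auto simp: swap_mem)
qed

lemma partial_embedding_add_row:
  assumes emb: "partial_embedding E P F S f g"
    and "(x, y) \<in> P" and fresh: "y' \<notin> snd ` P" "c \<notin> g ` snd ` P"
    and only: "\<And>w. w \<in> P \<Longrightarrow> {(x, y'), w} \<in> E \<Longrightarrow> w = (x, y)" and "{(x, y')} \<notin> E"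
    and "(f x, c) \<in> S" "{(f x, g y), (f x, c)} \<in> F"
  shows "partial_embedding E (insert (x, y') P) F S f (g(y' := c))"
proof -
  have swap_mem: "prod.swap ` A \<in> X" if "A \<in> (`) prod.swap ` X"
    for A :: "(nat \<times> nat) set" and X
    using that by (auto simp: image_image)
  have "partial_embedding ((`) prod.swap ` E) (insert (y', x) (prod.swap ` P))
      ((`) prod.swap ` F) (prod.swap ` S) (g(y' := c)) f"
  proof (rule partial_embedding_add_column[of _ _ _ _ _ _ y])
    show "partial_embedding ((`) prod.swap ` E) (prod.swap ` P) ((`) prod.swap ` F) (prod.swap ` S) g f"
      using emb by (simp only: partial_embedding_swap)
    show "w = (y, x)" if "w \<in> prod.swap ` P" "{(y', x), w} \<in> (`) prod.swap ` E" for w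
      using only[of "prod.swap w"] swap_mem[OF that(2)] that(1) by auto
    show "{(y', x)} \<notin> (`) prod.swap ` E"
      using swap_mem[of "{(y', x)}" E] assms(6) by auto
    show "{(g y, f x), (c, f x)} \<in> (`) prod.swap ` F"
      using imageI[OF assms(8), of "(`) prod.swap"] by simp
  qed (use assms in \<open>force simp: image_image image_iff\<close>)+
  moreover have "insert (y', x) (prod.swap ` P) = prod.swap ` insert (x, y') P" by simp
  ultimately show ?thesis by (simp only: partial_embedding_swap)
qed

text \<open>A maximal connected vertex set that embeds must be the whole tree: an edge leaving it
  leads to a vertex in a new column or row, and fewer than \<open>D\<close> of these are taken in
  the core.\<close>

lemma simple_tree_partial_embedding:
  assumes T: "simple_tree T"
    and "S \<noteq> {}" and D: "ncols T + nrows T < D"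
    and core: "\<And>v b. v \<in> S \<Longrightarrow> D \<le> card {w \<in> S. line_adjacent G b v w}"
  shows "\<exists>f g. partial_embedding (gedges T) (gverts T) (gedges G) S f g"
proof -
  let ?V = "gverts T" and ?E = "gedges T"
  \<comment> \<open>Connectedness is carried along because it makes the link to a new vertex unique
    and its line fresh.\<close>
  define good where "good P \<longleftrightarrow> P \<subseteq> ?V \<and> P \<noteq> {} \<and> graph_connected P (induced_edges ?E P) \<and>
    (\<exists>f g. partial_embedding ?E P (gedges G) S f g)" for P
  have sub: "?V \<subseteq> {1..ncols T} \<times> {1..nrows T}"
    and edges: "\<And>e. e \<in> ?E \<Longrightarrow> \<exists>u\<in>?V. \<exists>v\<in>?V. e = {u, v} \<and> u \<noteq> v \<and> (fst u = fst v \<or> snd u = snd v)"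
    and conn: "graph_connected ?V ?E" and acyclic: "\<nexists>cs. graph_cycle ?E cs" and "?V \<noteq> {}"
    using T by (auto simp: simple_tree_def grid_subgraph_def graph_tree_def)
  have lines: "graph_connected {a \<in> ?V. snd a = snd v} (induced_edges ?E {a \<in> ?V. snd a = snd v})"
      "graph_connected {a \<in> ?V. fst a = fst v} (induced_edges ?E {a \<in> ?V. fst a = fst v})"
    if "v \<in> ?V" for v
    using T that sub unfolding simple_tree_def simple_grid_def row_verts_def col_verts_def by auto
  have loopless: "{v} \<notin> ?E" for v
    using edges[of "{v}"] by (auto simp: singleton_insert_inj_eq)
  have "finite ?V" using sub by (rule finite_subset) simp
  obtain v0 s where "v0 \<in> ?V" "s \<in> S" using \<open>?V \<noteq> {}\<close> \<open>S \<noteq> {}\<close> by blast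
  \<comment> \<open>Constant maps are injective on a single vertex.\<close>
  then have "partial_embedding ?E {v0} (gedges G) S (\<lambda>_. fst s) (\<lambda>_. snd s)"
    using loopless by (cases v0) (auto simp: partial_embedding_def)
  then have "good {v0}"
    using \<open>v0 \<in> ?V\<close> by (auto simp: good_def graph_connected_def)
  moreover have "finite {P. good P}"
    by (rule finite_subset[of _ "Pow ?V"]) (use \<open>finite ?V\<close> in \<open>auto simp: good_def\<close>)
  ultimately obtain P where P: "good P" and maximal: "\<And>Q. good Q \<Longrightarrow> P \<subseteq> Q \<Longrightarrow> P = Q"
    using finite_has_maximal[of "{P. good P}"] by blast
  then obtain f g where emb: "partial_embedding ?E P (gedges G) S f g"
    and PV: "P \<subseteq> ?V" "P \<noteq> {}" and Pconn: "graph_connected P (induced_edges ?E P)"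
    by (auto simp: good_def)
  have "P = ?V"
  proof (rule ccontr)
    assume "P \<noteq> ?V"
    then obtain u v where uv: "u \<in> P" "v \<notin> P" "{u, v} \<in> ?E"
      using graph_connected_crossing_edge[OF conn PV] by blast
    with edges[OF uv(3)] have v: "v \<in> ?V" "u \<noteq> v" "fst u = fst v \<or> snd u = snd v"
      by (auto simp: doubleton_eq_iff)
    have only: "w = u" if "w \<in> P" "{v, w} \<in> ?E" for w
      using unique_edge_into_connected_part[OF acyclic Pconn uv(3,1,2) that] .
    obtain x y x' y' where coords: "u = (x, y)" "v = (x', y')" by (cases u; cases v) auto
    have "finite P" using PV \<open>finite ?V\<close> by (simp add: finite_subset)
    have used: "card (f ` fst ` P) < D" "card (g ` snd ` P) < D"
    proof -
      have "fst ` P \<subseteq> {1..ncols T}" "snd ` P \<subseteq> {1..nrows T}"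
        using PV sub by auto
      then have "card (fst ` P) \<le> ncols T" "card (snd ` P) \<le> nrows T"
        by (metis card_mono finite_atLeastAtMost card_atLeastAtMost diff_Suc_1)+
      then show "card (f ` fst ` P) < D" "card (g ` snd ` P) < D"
        using card_image_le[of "fst ` P" f] card_image_le[of "snd ` P" g] \<open>finite P\<close> D by auto
    qed
    have uS: "(f x, g y) \<in> S"
      using emb uv(1) coords by (force simp: partial_embedding_def)
    have "\<exists>f g. partial_embedding ?E (insert v P) (gedges G) S f g"
    proof (cases "snd u = snd v")
      case True
      \<comment> \<open>Being distinct and in the same row, \<open>u\<close> and \<open>v\<close>
        differ in their columns.\<close>
      then have fresh: "fst v \<notin> fst ` P"
        using line_fresh_for_connected_part[OF acyclic Pconn uv(3,1,2) PV(1) v(1)] lines(2)[OF v(1)] v(2)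
        by (auto simp: prod_eq_iff)
      let ?W = "{w \<in> S. line_adjacent G True (f x, g y) w}"
      \<comment> \<open>Vertices of one row are told apart by their columns, so at least
        \<open>D\<close> columns are on offer, more than the image of \<open>P\<close>
        occupies.\<close>
      have "inj_on fst ?W" by (auto simp: inj_on_def line_adjacent_def line_def)
      then have "card (f ` fst ` P) < card (fst ` ?W)"
        using core[OF uS, of True] used(1) by (simp add: card_image)
      then have "\<not> fst ` ?W \<subseteq> f ` fst ` P"
        using \<open>finite P\<close> card_mono[of "f ` fst ` P" "fst ` ?W"] by auto
      then obtain w where "w \<in> ?W" "fst w \<notin> f ` fst ` P" by blast
      then obtain c where "c \<notin> f ` fst ` P" "(c, g y) \<in> S" "{(f x, g y), (c, g y)} \<in> gedges G"
        by (cases w) (simp add: line_adjacent_def line_def)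
      then have "partial_embedding ?E (insert (x', y) P) (gedges G) S (f(x' := c)) g"
        using partial_embedding_add_column[OF emb, of x y x' c] fresh only loopless uv True coords by simp
      with True coords show ?thesis by auto
    next
      case False
      \<comment> \<open>Now the edge lies in a column, and rows and columns exchange roles.\<close>
      with v have "fst u = fst v" by blast
      have fresh: "snd v \<notin> snd ` P"
        using line_fresh_for_connected_part[OF acyclic Pconn uv(3,1,2) PV(1) v(1) False lines(1)[OF v(1)]] .
      let ?W = "{w \<in> S. line_adjacent G False (f x, g y) w}"
      have "inj_on snd ?W" by (auto simp: inj_on_def line_adjacent_def line_def)
      then have "card (g ` snd ` P) < card (snd ` ?W)"
        using core[OF uS, of False] used(2) by (simp add: card_image)
      then have "\<not> snd ` ?W \<subseteq> g ` snd ` P"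
        using \<open>finite P\<close> card_mono[of "g ` snd ` P" "snd ` ?W"] by auto
      then obtain w where "w \<in> ?W" "snd w \<notin> g ` snd ` P" by blast
      then obtain c where "c \<notin> g ` snd ` P" "(f x, c) \<in> S" "{(f x, g y), (f x, c)} \<in> gedges G"
        by (cases w) (simp add: line_adjacent_def line_def)
      then have "partial_embedding ?E (insert (x, y') P) (gedges G) S f (g(y' := c))"
        using partial_embedding_add_row[OF emb, of x y y' c] fresh only loopless uv \<open>fst u = fst v\<close> coords
        by simp
      with \<open>fst u = fst v\<close> coords show ?thesis by auto
    qed
    then have "good (insert v P)"
      using graph_connected_insert[OF Pconn uv(3,1)] PV v(1) by (auto simp: good_def)
    with maximal[of "insert v P"] uv(2) show False by blast
  qed
  with emb show ?thesis by blast
qed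

section \<open>Full embeddings and the linear bound\<close>

lemma inj_on_extend:
  assumes "finite B" "finite C" "A \<subseteq> B" "card B \<le> card C" and f: "inj_on f A" "f ` A \<subseteq> C"
  obtains g where "inj_on g B" "g ` B \<subseteq> C" "\<And>a. a \<in> A \<Longrightarrow> g a = f a"
proof -
  have "finite A" using assms finite_subset by blast
  \<comment> \<open>Outside the image of \<open>A\<close> there remain at least as many values as
    there are arguments to fill in.\<close>
  have "card (B - A) \<le> card (C - f ` A)"
    using assms \<open>finite A\<close> by (simp add: card_Diff_subset card_image)
  then obtain h where h: "h ` (B - A) \<subseteq> C - f ` A" "inj_on h (B - A)"
    using card_le_inj[of "B - A" "C - f ` A"] assms by auto
  let ?g = "\<lambda>a. if a \<in> A then f a else h a"
  have "inj_on ?g B"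
  proof (rule inj_onI)
    fix a b assume "a \<in> B" "b \<in> B" "?g a = ?g b"
    moreover have "h z \<noteq> f x" if "z \<in> B" "z \<notin> A" "x \<in> A" for x z
      using h(1) that by blast
    ultimately show "a = b"
      using inj_onD[OF f(1), of a b] inj_onD[OF h(2), of a b] by (auto split: if_splits dest: sym)
  qed
  moreover have "?g ` B \<subseteq> C" using f h by auto
  ultimately show thesis using that[of ?g] by simp
qed

lemma gr_property_simple_tree:
  assumes T: "simple_tree T" and "1 \<le> k" and D: "ncols T + nrows T < D"
  shows "gr_property T k (2 * D * k)"
  unfolding gr_property_def
proof (intro allI impI)
  let ?N = "2 * D * k"
  fix G assume G: "spanning_grid_subgraph ?N G"
  have V: "gverts G = {1..?N} \<times> {1..?N}" and dims: "ncols G = ?N" "nrows G = ?N"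
    using G by (simp_all add: spanning_grid_subgraph_def complete_grid_def)
  \<comment> \<open>As \<open>k\<close> is at least 1, the host has room for all columns and rows of
    \<open>T\<close>, empty ones included.\<close>
  have "D \<le> ?N" using \<open>1 \<le> k\<close> by (cases k) auto
  then have N: "?N > 0" "ncols T \<le> ?N" "nrows T \<le> ?N" using D by linarith+
  show "grid_contains G T \<or> (\<exists>S. grid_coclique G k S)"
  proof (cases "\<exists>S. grid_coclique G k S")
    case False
    obtain S where S: "S \<subseteq> gverts G" "S \<noteq> {}"
      "\<And>v b. v \<in> S \<Longrightarrow> D \<le> card {w \<in> S. line_adjacent G b v w}"
      using dense_core_or_coclique[OF G refl N(1) False] by blast
    obtain f g where emb: "partial_embedding (gedges T) (gverts T) (gedges G) S f g"
      using simple_tree_partial_embedding[OF T S(2) D S(3)] by blast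
    have TV: "gverts T \<subseteq> {1..ncols T} \<times> {1..nrows T}"
      and edges: "\<And>e. e \<in> gedges T \<Longrightarrow> e \<subseteq> gverts T"
      using T by (fastforce simp: simple_tree_def grid_subgraph_def)+
    have image: "map_prod f g ` gverts T \<subseteq> {1..?N} \<times> {1..?N}"
      using emb S(1) V by (auto simp: partial_embedding_def)
    have "f ` fst ` gverts T \<subseteq> {1..?N}" "g ` snd ` gverts T \<subseteq> {1..?N}"
      using image by force+
    moreover have "fst ` gverts T \<subseteq> {1..ncols T}" "snd ` gverts T \<subseteq> {1..nrows T}"
      using TV by auto
    moreover have "inj_on f (fst ` gverts T)" "inj_on g (snd ` gverts T)"
      using emb by (simp_all add: partial_embedding_def)
    moreover have "card {1..ncols T} \<le> card {1..?N}" "card {1..nrows T} \<le> card {1..?N}"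
      using N by simp_all
    moreover note finite_atLeastAtMost[of 1 "ncols T"] finite_atLeastAtMost[of 1 "nrows T"]
      finite_atLeastAtMost[of 1 ?N]
    \<comment> \<open>A grid embedding must be injective on all indices of columns and rows of
      \<open>T\<close>, even those without vertices, about which \<open>f\<close> and
      \<open>g\<close> say nothing.\<close>
    ultimately obtain \<phi>c \<phi>r where
        c: "inj_on \<phi>c {1..ncols T}" "\<phi>c ` {1..ncols T} \<subseteq> {1..?N}"
          "\<And>x. x \<in> fst ` gverts T \<Longrightarrow> \<phi>c x = f x"
        and r: "inj_on \<phi>r {1..nrows T}" "\<phi>r ` {1..nrows T} \<subseteq> {1..?N}"
          "\<And>y. y \<in> snd ` gverts T \<Longrightarrow> \<phi>r y = g y"
      using inj_on_extend[of "{1..ncols T}" "{1..?N}" "fst ` gverts T" f]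
        inj_on_extend[of "{1..nrows T}" "{1..?N}" "snd ` gverts T" g] by metis
    have "{(\<phi>c x, \<phi>r y), (\<phi>c x', \<phi>r y')} \<in> gedges G" if e: "{(x, y), (x', y')} \<in> gedges T" for x y x' y'
    proof -
      have mem: "(x, y) \<in> gverts T" "(x', y') \<in> gverts T" using edges[OF e] by auto
      then have "{map_prod f g (x, y), map_prod f g (x', y')} \<in> gedges G"
        using emb e unfolding partial_embedding_def by blast
      moreover have "\<phi>c x = f x" "\<phi>c x' = f x'" "\<phi>r y = g y" "\<phi>r y' = g y'"
        using c(3) r(3) mem[THEN imageI, of fst] mem[THEN imageI, of snd] by simp_all
      ultimately show ?thesis by simp
    qed
    then have "grid_embedding \<phi>c \<phi>r T G"
      using c r dims unfolding grid_embedding_def by auto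
    then show ?thesis unfolding grid_contains_def by blast
  qed blast
qed

theorem theorem1p3:
  fixes T :: grid_graph
  assumes "simple_tree T"
  shows "\<exists>C::real. \<forall>k::nat. k \<ge> 1 \<longrightarrow>
           (\<exists>N. gr_property T k N) \<and> real (gr T k) \<le> C * real k"
proof (intro exI[of _ "real (2 * (ncols T + nrows T + 1))"] allI impI)
  fix k :: nat assume "k \<ge> 1"
  \<comment> \<open>The least admissible \<open>D\<close> is one more than the columns and rows of
    \<open>T\<close> together; the constant is twice this \<open>D\<close>.\<close>
  let ?N = "2 * (ncols T + nrows T + 1) * k"
  have N: "gr_property T k ?N"
    by (rule gr_property_simple_tree[OF assms \<open>k \<ge> 1\<close>]) simp
  then have "gr T k \<le> ?N"
    unfolding gr_def by (rule Least_le)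
  then have "real (gr T k) \<le> real (2 * (ncols T + nrows T + 1)) * real k"
    by (metis of_nat_le_iff of_nat_mult)
  with N show "(\<exists>N. gr_property T k N) \<and>
      real (gr T k) \<le> real (2 * (ncols T + nrows T + 1)) * real k" by blast
qed

end
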